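(* Let $S\subseteq\mathbb{H}$ be open and let $f:S\to\mathbb{H}$ be continuous, such that its left HR derivatives exist and are continuous in $S$. If $q_0,q_1\in S$ are such that the segment joining them is also in $S$, then, with $\lambda=q_1-q_0$, $$f(q_1)-f(q_0)=\int_0^1\left(\frac{\partial f(q_0+t\lambda)}{\partial q}\lambda+\frac{\partial f(q_0+t\lambda)}{\partial q^i}\lambda^i+\frac{\partial f(q_0+t\lambda)}{\partial q^j}\lambda^j+\frac{\partial f(q_0+t\lambda)}{\partial q^k}\lambda^k\right)dt$$ $$=\int_0^1\left(\frac{\partial f(q_0+t\lambda)}{\partial q^*}\lambda^*+\frac{\partial f(q_0+t\lambda)}{\partial q^{i*}}\lambda^{i*}+\frac{\partial f(q_0+t\lambda)}{\partial q^{j*}}\lambda^{j*}+\frac{\partial f(q_0+t\lambda)}{\partial q^{k*}}\lambda^{k*}\right)dt .$$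
   Context: $\mathbb{H}$ denotes the real quaternions $q=q_a+iq_b+jq_c+kq_d$ with $q_a,q_b,q_c,q_d\in\mathbb{R}$ and $i^2=j^2=k^2=ijk=-1$. The conjugate is $q^*=q_a-iq_b-jq_c-kq_d$. For $\mu\in\{1,i,j,k\}$ and $p\in\mathbb{H}$, $p^{\mu}:=\mu p\mu^{-1}$ and $p^{\mu*}:=(p^{\mu})^*$. An $\mathbb{H}$-valued function $f$ is regarded as a function of the four real variables $q_a,q_b,q_c,q_d$, with ($\mathbb{H}$-valued, componentwise) partial derivatives $\frac{\partial f}{\partial q_a},\dots,\frac{\partial f}{\partial q_d}$. The left HR derivatives of $f$ are, for $\mu\in\{1,i,j,k\}$, $$\frac{\partial f}{\partial q^{\mu}}=\frac14\left(\frac{\partial f}{\partial q_a}-\frac{\partial f}{\partial q_b}i^{\mu}-\frac{\partial f}{\partial q_c}j^{\mu}-\frac{\partial f}{\partial q_d}k^{\mu}\right),\qquad \frac{\partial f}{\partial q^{\mu*}}=\frac14\left(\frac{\partial f}{\partial q_a}+\frac{\partial f}{\partial q_b}i^{\mu}+\frac{\partial f}{\partial q_c}j^{\mu}+\frac{\partial f}{\partial q_d}k^{\mu}\right),$$ where for $\mu=1$ one writes $\frac{\partial f}{\partial q}$ and $\frac{\partial f}{\partial q^*}$. $\frac{\partial f(q_0+t\lambda)}{\partial q^{\mu}}$ denotes this derivative evaluated at the point $q_0+t\lambda$. Integrals of $\mathbb{H}$-valued functions are taken componentwise. *)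

theory Defs
  imports "HOL-Analysis.Analysis"
begin

datatype quat = Quat (q_a: real) (q_b: real) (q_c: real) (q_d: real)

lemma quat_eq_iff: "p = q \<longleftrightarrow> q_a p = q_a q \<and> q_b p = q_b q \<and> q_c p = q_c q \<and> q_d p = q_d q"
  by (auto intro: quat.expand)

instantiation quat :: "{zero, one, plus, minus, uminus, times, inverse, scaleR}"
begin

definition zero_quat where "0 = Quat 0 0 0 0"

definition one_quat where "1 = Quat 1 0 0 0"

definition plus_quat where
  "p + q = Quat (q_a p + q_a q) (q_b p + q_b q) (q_c p + q_c q) (q_d p + q_d q)"

definition minus_quat where
  "p - q = Quat (q_a p - q_a q) (q_b p - q_b q) (q_c p - q_c q) (q_d p - q_d q)"

definition uminus_quat where "- q = Quat (- q_a q) (- q_b q) (- q_c q) (- q_d q)"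

definition scaleR_quat where
  "r *\<^sub>R q = Quat (r * q_a q) (r * q_b q) (r * q_c q) (r * q_d q)"

definition times_quat where
  "p * q = Quat
     (q_a p * q_a q - q_b p * q_b q - q_c p * q_c q - q_d p * q_d q)
     (q_a p * q_b q + q_b p * q_a q + q_c p * q_d q - q_d p * q_c q)
     (q_a p * q_c q - q_b p * q_d q + q_c p * q_a q + q_d p * q_b q)
     (q_a p * q_d q + q_b p * q_c q - q_c p * q_b q + q_d p * q_a q)"

definition inverse_quat where
  "inverse q = inverse ((q_a q)\<^sup>2 + (q_b q)\<^sup>2 + (q_c q)\<^sup>2 + (q_d q)\<^sup>2) *\<^sub>R
     Quat (q_a q) (- q_b q) (- q_c q) (- q_d q)"

definition divide_quat where "(p::quat) div q = p * inverse q"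

instance ..

end

lemma quat_sel_simps [simp]:
  "q_a 0 = 0" "q_b 0 = 0" "q_c 0 = 0" "q_d 0 = 0"
  "q_a 1 = 1" "q_b 1 = 0" "q_c 1 = 0" "q_d 1 = 0"
  "q_a (p + q) = q_a p + q_a q" "q_b (p + q) = q_b p + q_b q"
  "q_c (p + q) = q_c p + q_c q" "q_d (p + q) = q_d p + q_d q"
  "q_a (p - q) = q_a p - q_a q" "q_b (p - q) = q_b p - q_b q"
  "q_c (p - q) = q_c p - q_c q" "q_d (p - q) = q_d p - q_d q"
  "q_a (- q) = - q_a q" "q_b (- q) = - q_b q" "q_c (- q) = - q_c q" "q_d (- q) = - q_d q"
  "q_a (r *\<^sub>R q) = r * q_a q" "q_b (r *\<^sub>R q) = r * q_b q"
  "q_c (r *\<^sub>R q) = r * q_c q" "q_d (r *\<^sub>R q) = r * q_d q"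
  "q_a (p * q) = q_a p * q_a q - q_b p * q_b q - q_c p * q_c q - q_d p * q_d q"
  "q_b (p * q) = q_a p * q_b q + q_b p * q_a q + q_c p * q_d q - q_d p * q_c q"
  "q_c (p * q) = q_a p * q_c q - q_b p * q_d q + q_c p * q_a q + q_d p * q_b q"
  "q_d (p * q) = q_a p * q_d q + q_b p * q_c q - q_c p * q_b q + q_d p * q_a q"
  by (simp_all add: zero_quat_def one_quat_def plus_quat_def minus_quat_def uminus_quat_def
      scaleR_quat_def times_quat_def)

instance quat :: real_algebra_1
  by standard (simp_all add: quat_eq_iff algebra_simps)

lemma quat_sum_squares_eq_0:
  "(q_a q)\<^sup>2 + (q_b q)\<^sup>2 + (q_c q)\<^sup>2 + (q_d q)\<^sup>2 = 0 \<longleftrightarrow> q = 0"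
  by (simp add: quat_eq_iff add_nonneg_eq_0_iff)

instance quat :: real_div_algebra
proof
  fix p q :: quat
  have *: "inverse s * a * a + inverse s * b * b + inverse s * c * c + inverse s * d * d = 1"
    if "s = a\<^sup>2 + b\<^sup>2 + c\<^sup>2 + d\<^sup>2" "s \<noteq> 0" for s a b c d :: real
  proof -
    have "inverse s * a * a + inverse s * b * b + inverse s * c * c + inverse s * d * d
        = inverse s * (a\<^sup>2 + b\<^sup>2 + c\<^sup>2 + d\<^sup>2)"
      by (simp add: algebra_simps power2_eq_square)
    then show ?thesis using that by simp
  qed
  show "inverse q * q = 1" if "q \<noteq> 0"
    using *[OF refl iffD2[OF quat_sum_squares_eq_0[THEN arg_cong[of _ _ Not]] that]]
    by (simp add: quat_eq_iff[of _ 1] inverse_quat_def algebra_simps)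
  show "q * inverse q = 1" if "q \<noteq> 0"
    using *[OF refl iffD2[OF quat_sum_squares_eq_0[THEN arg_cong[of _ _ Not]] that]]
    by (simp add: quat_eq_iff[of _ 1] inverse_quat_def algebra_simps)
  show "p div q = p * inverse q"
    by (rule divide_quat_def)
  show "inverse (0::quat) = 0"
    by (simp add: inverse_quat_def quat_eq_iff)
qed

instantiation quat :: real_inner
begin

definition inner_quat where
  "inner p q = q_a p * q_a q + q_b p * q_b q + q_c p * q_c q + q_d p * q_d q"

definition norm_quat where "norm (q::quat) = sqrt (inner q q)"

definition sgn_quat where "sgn (q::quat) = q /\<^sub>R norm q"

definition dist_quat where "dist (p::quat) q = norm (p - q)"

definition uniformity_quat where
  "(uniformity :: (quat \<times> quat) filter) = (INF e\<in>{0 <..}. principal {(x, y). dist x y < e})"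

definition open_quat where
  "open (U :: quat set) \<longleftrightarrow> (\<forall>x\<in>U. eventually (\<lambda>(x', y). x' = x \<longrightarrow> y \<in> U) uniformity)"

instance
proof
  fix p q s :: quat and r :: real and U :: "quat set"
  show "dist p q = norm (p - q)" by (rule dist_quat_def)
  show "sgn q = q /\<^sub>R norm q" by (rule sgn_quat_def)
  show "(uniformity :: (quat \<times> quat) filter) = (INF e\<in>{0 <..}. principal {(x, y). dist x y < e})"
    by (rule uniformity_quat_def)
  show "open U \<longleftrightarrow> (\<forall>x\<in>U. eventually (\<lambda>(x', y). x' = x \<longrightarrow> y \<in> U) uniformity)"
    by (rule open_quat_def)
  show "inner p q = inner q p" by (simp add: inner_quat_def algebra_simps)
  show "inner (p + q) s = inner p s + inner q s" by (simp add: inner_quat_def algebra_simps)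
  show "inner (r *\<^sub>R p) q = r * inner p q" by (simp add: inner_quat_def algebra_simps)
  show "0 \<le> inner p p" by (simp add: inner_quat_def)
  show "inner p p = 0 \<longleftrightarrow> p = 0"
    using quat_sum_squares_eq_0[of p] by (simp add: inner_quat_def power2_eq_square)
  show "norm p = sqrt (inner p p)" by (rule norm_quat_def)
qed

end

instance quat :: real_normed_div_algebra
proof
  fix p q :: quat
  have "inner (p * q) (p * q) = inner p p * inner q q"
    unfolding inner_quat_def by simp algebra
  then show "norm (p * q) = norm p * norm q"
    by (simp add: norm_quat_def real_sqrt_mult)
qed

definition quat_i :: quat where "quat_i = Quat 0 1 0 0"

definition quat_j :: quat where "quat_j = Quat 0 0 1 0"

definition quat_k :: quat where "quat_k = Quat 0 0 0 1"

lemma quat_units_sel [simp]: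
  "q_a quat_i = 0" "q_b quat_i = 1" "q_c quat_i = 0" "q_d quat_i = 0"
  "q_a quat_j = 0" "q_b quat_j = 0" "q_c quat_j = 1" "q_d quat_j = 0"
  "q_a quat_k = 0" "q_b quat_k = 0" "q_c quat_k = 0" "q_d quat_k = 1"
  by (simp_all add: quat_i_def quat_j_def quat_k_def)

instantiation quat :: euclidean_space
begin

definition Basis_quat where "Basis = {1, quat_i, quat_j, quat_k}"

instance
proof
  fix u v :: quat
  show "(Basis :: quat set) \<noteq> {}" by (simp add: Basis_quat_def)
  show "finite (Basis :: quat set)" by (simp add: Basis_quat_def)
  show "inner u v = (if u = v then 1 else 0)" if "u \<in> Basis" "v \<in> Basis"
    using that by (auto simp: Basis_quat_def inner_quat_def quat_eq_iff)
  show "(\<forall>u\<in>Basis. inner v u = 0) \<longleftrightarrow> v = 0"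
    by (simp add: Basis_quat_def inner_quat_def quat_eq_iff[of v])
qed

end

lemma quat_decomp:
  "q = of_real (q_a q) + quat_i * of_real (q_b q) + quat_j * of_real (q_c q) + quat_k * of_real (q_d q)"
  by (simp add: quat_eq_iff of_real_def)

lemma quat_units_mult:
  "quat_i\<^sup>2 = -1" "quat_j\<^sup>2 = -1" "quat_k\<^sup>2 = -1" "quat_i * quat_j * quat_k = -1"
  by (simp_all add: quat_eq_iff power2_eq_square)

definition quat_cnj :: "quat \<Rightarrow> quat" where
  "quat_cnj q = Quat (q_a q) (- q_b q) (- q_c q) (- q_d q)"

text \<open>The involution \<open>p\<^sup>\<mu>\<close>; it is only used for \<open>\<mu>\<close> in \<open>quat_units\<close>.\<close>

definition quat_rot :: "quat \<Rightarrow> quat \<Rightarrow> quat" where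
  "quat_rot \<mu> p = \<mu> * p * inverse \<mu>"

definition quat_units :: "quat set" where
  "quat_units = {1, quat_i, quat_j, quat_k}"

text \<open>
  The derivative along \<open>e\<close>; the partial derivatives with respect to \<open>q_a\<close>, \<open>q_b\<close>, \<open>q_c\<close>, \<open>q_d\<close> are
  those with \<open>e\<close> equal to 1, \<open>quat_i\<close>, \<open>quat_j\<close>, \<open>quat_k\<close>. Only the values of \<open>f\<close> near \<open>q\<close> matter,
  so a function on an open set may be represented by any total extension.
\<close>

definition quat_partial :: "quat \<Rightarrow> (quat \<Rightarrow> quat) \<Rightarrow> quat \<Rightarrow> quat" where
  "quat_partial e f q = vector_derivative (\<lambda>t::real. f (q + t *\<^sub>R e)) (at 0)"

text \<open>
  Every HR derivative at \<open>q\<close> is built from all four partial derivatives at \<open>q\<close>, so it exists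
  when these do. Without this condition the values below are meaningless.
\<close>

definition HR_differentiable_at :: "(quat \<Rightarrow> quat) \<Rightarrow> quat \<Rightarrow> bool" where
  "HR_differentiable_at f q \<longleftrightarrow>
     (\<forall>e\<in>quat_units. (\<lambda>t::real. f (q + t *\<^sub>R e)) differentiable (at 0))"

definition HR_deriv :: "quat \<Rightarrow> (quat \<Rightarrow> quat) \<Rightarrow> quat \<Rightarrow> quat" where
  "HR_deriv \<mu> f q = (1/4) *\<^sub>R
     (quat_partial 1 f q - quat_partial quat_i f q * quat_rot \<mu> quat_i
      - quat_partial quat_j f q * quat_rot \<mu> quat_j - quat_partial quat_k f q * quat_rot \<mu> quat_k)"

text \<open>The derivative with respect to \<open>q\<^sup>\<mu>\<^sup>*\<close>.\<close>

definition HR_deriv_cnj :: "quat \<Rightarrow> (quat \<Rightarrow> quat) \<Rightarrow> quat \<Rightarrow> quat" where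
  "HR_deriv_cnj \<mu> f q = (1/4) *\<^sub>R
     (quat_partial 1 f q + quat_partial quat_i f q * quat_rot \<mu> quat_i
      + quat_partial quat_j f q * quat_rot \<mu> quat_j + quat_partial quat_k f q * quat_rot \<mu> quat_k)"

end

theory Submission
  imports Defs
begin

text \<open>
  The two integrands are one and the same function in disguise. Substituting the definition of the
  HR derivatives into \<open>\<Sum>\<^sub>\<mu> (\<partial>f/\<partial>q\<^sup>\<mu>) h\<^sup>\<mu>\<close>, the partial derivative along a unit \<open>e\<close> gets
  multiplied on the right by \<open>1/4\<close> of a sum over \<open>\<mu>\<close> of \<open>(\<plusminus>e h)\<^sup>\<mu>\<close>, since rotations are
  multiplicative. The four rotated copies of a quaternion add up to four times its real part, so
  what is left is the real number \<open>h \<bullet> e\<close>. The conjugate sum gives the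
  same number, because \<open>e\<^sup>\<mu> (h\<^sup>\<mu>)\<^sup>* = (e h\<^sup>*)\<^sup>\<mu>\<close> and \<open>e h\<^sup>*\<close> has real part \<open>h \<bullet> e\<close>. Both sums are thus the classical
  differential \<open>\<Sum>\<^sub>e (h \<bullet> e) \<partial>f/\<partial>e\<close> (\<open>HR_deriv_sum\<close>, \<open>HR_deriv_cnj_sum\<close>).

  Taking \<open>h\<close> to be one of the units \<open>e\<close> in this identity recovers each partial derivative from the
  HR derivatives. So continuity of the HR derivatives gives continuity of the partial derivatives,
  hence \<open>f\<close> is Frechet differentiable (\<open>has_derivative_of_continuous_partials\<close>), and its
  differential applied to \<open>\<lambda>\<close> is the derivative of \<open>t \<mapsto> f (q\<^sub>0 + t \<lambda>)\<close>. The fundamental theorem of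
  calculus finishes the proof.
\<close>

section \<open>Continuous partial derivatives imply differentiability\<close>

lemma has_vector_derivative_along_line:
  fixes f :: "'a::real_normed_vector \<Rightarrow> 'b::real_normed_vector"
  assumes "((\<lambda>t::real. f (y + s *\<^sub>R b + t *\<^sub>R b)) has_vector_derivative v) (at 0)"
  shows "((\<lambda>t. f (y + t *\<^sub>R b)) has_vector_derivative v) (at s)"
proof -
  have "((\<lambda>t. f (y + s *\<^sub>R b + t *\<^sub>R b)) \<circ> (\<lambda>t. t - s) has_vector_derivative 1 *\<^sub>R v) (at s)"
    by (rule vector_diff_chain_at) (auto intro!: derivative_eq_intros simp: assms)
  moreover have "(\<lambda>t. f (y + s *\<^sub>R b + t *\<^sub>R b)) \<circ> (\<lambda>t. t - s) = (\<lambda>t. f (y + t *\<^sub>R b))"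
    by (auto simp: fun_eq_iff algebra_simps)
  ultimately show ?thesis by simp
qed

text \<open>
  Moving from \<open>x\<close> to \<open>x + h\<close> one coordinate at a time, each step is a one-dimensional problem: by the
  mean value inequality its error is at most the step length times the oscillation of the partial
  derivative. The condition on the sum of the coordinates keeps the whole staircase in the ball.
\<close>

lemma coordinatewise_increment_bound:
  fixes f :: "'a::euclidean_space \<Rightarrow> 'b::real_normed_vector"
  assumes deriv: "\<And>y b. y \<in> ball x d \<Longrightarrow> b \<in> Basis \<Longrightarrow>
      ((\<lambda>t::real. f (y + t *\<^sub>R b)) has_vector_derivative g b y) (at 0)"
    and osc: "\<And>y b. y \<in> ball x d \<Longrightarrow> b \<in> Basis \<Longrightarrow> norm (g b y - g b x) \<le> e"
    and h: "(\<Sum>b\<in>Basis. \<bar>h \<bullet> b\<bar>) < d"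
    and A: "finite A" "A \<subseteq> Basis"
  shows "norm (f (x + (\<Sum>b\<in>A. (h \<bullet> b) *\<^sub>R b)) - f x - (\<Sum>b\<in>A. (h \<bullet> b) *\<^sub>R g b x))
      \<le> e * (\<Sum>b\<in>A. \<bar>h \<bullet> b\<bar>)"
  using A
proof (induction A rule: finite_induct)
  case empty
  then show ?case by simp
next
  case (insert b A)
  have bB: "b \<in> Basis" and AB: "A \<subseteq> Basis" using insert.prems by auto
  define y where "y = x + (\<Sum>b\<in>A. (h \<bullet> b) *\<^sub>R b)"
  define s where "s = h \<bullet> b"
  define S where "S = closed_segment 0 s"
  define \<phi> where "\<phi> t = f (y + t *\<^sub>R b) - t *\<^sub>R g b x" for t
  have inball: "y + t *\<^sub>R b \<in> ball x d" if "t \<in> S" for t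
  proof -
    have "\<bar>t\<bar> \<le> \<bar>s\<bar>"
      using that by (auto simp: S_def closed_segment_eq_real_ivl split: if_splits)
    have "dist x (y + t *\<^sub>R b) = norm ((\<Sum>b\<in>A. (h \<bullet> b) *\<^sub>R b) + t *\<^sub>R b)"
      by (subst dist_commute) (simp add: dist_norm y_def)
    also have "\<dots> \<le> norm (\<Sum>b\<in>A. (h \<bullet> b) *\<^sub>R b) + norm (t *\<^sub>R b)"
      by (rule norm_triangle_ineq)
    also have "\<dots> \<le> (\<Sum>b\<in>A. \<bar>h \<bullet> b\<bar>) + \<bar>s\<bar>"
    proof (rule add_mono)
      show "norm (\<Sum>b\<in>A. (h \<bullet> b) *\<^sub>R b) \<le> (\<Sum>b\<in>A. \<bar>h \<bullet> b\<bar>)"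
        using AB by (intro sum_norm_le) auto
      show "norm (t *\<^sub>R b) \<le> \<bar>s\<bar>"
        using \<open>\<bar>t\<bar> \<le> \<bar>s\<bar>\<close> bB by simp
    qed
    also have "\<dots> = (\<Sum>b\<in>insert b A. \<bar>h \<bullet> b\<bar>)"
      using insert.hyps by (simp add: s_def)
    also have "\<dots> \<le> (\<Sum>b\<in>Basis. \<bar>h \<bullet> b\<bar>)"
      using insert.prems by (intro sum_mono2) auto
    finally show ?thesis using h by simp
  qed
  have "norm (\<phi> s - \<phi> 0) \<le> e * norm (s - 0)"
  proof (rule differentiable_bound[where S = S and f = \<phi>
        and f' = "\<lambda>t u. u *\<^sub>R (g b (y + t *\<^sub>R b) - g b x)"])
    fix t assume t: "t \<in> S"
    have "((\<lambda>t. f (y + t *\<^sub>R b)) has_vector_derivative g b (y + t *\<^sub>R b)) (at t)"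
      by (rule has_vector_derivative_along_line) (rule deriv[OF inball[OF t] bB])
    then have "(\<phi> has_vector_derivative (g b (y + t *\<^sub>R b) - g b x)) (at t)"
      unfolding \<phi>_def by (auto intro!: derivative_eq_intros)
    then show "(\<phi> has_derivative (\<lambda>u. u *\<^sub>R (g b (y + t *\<^sub>R b) - g b x))) (at t within S)"
      by (auto simp: has_vector_derivative_def intro: has_derivative_at_withinI)
    show "onorm (\<lambda>u. u *\<^sub>R (g b (y + t *\<^sub>R b) - g b x)) \<le> e"
      using osc[OF inball[OF t] bB]
      by (intro onorm_le) (simp add: mult.commute[of e] mult_left_mono)
  qed (auto simp: S_def)
  then have step: "norm (f (y + s *\<^sub>R b) - f y - s *\<^sub>R g b x) \<le> e * \<bar>s\<bar>"
    by (simp add: \<phi>_def algebra_simps)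
  have "norm (f (x + (\<Sum>b\<in>insert b A. (h \<bullet> b) *\<^sub>R b)) - f x
          - (\<Sum>b\<in>insert b A. (h \<bullet> b) *\<^sub>R g b x))
      = norm ((f (y + s *\<^sub>R b) - f y - s *\<^sub>R g b x)
          + (f y - f x - (\<Sum>b\<in>A. (h \<bullet> b) *\<^sub>R g b x)))"
    using insert.hyps by (simp add: y_def s_def algebra_simps)
  also have "\<dots> \<le> e * \<bar>s\<bar> + e * (\<Sum>b\<in>A. \<bar>h \<bullet> b\<bar>)"
    using insert.IH[OF AB] step by (intro norm_triangle_mono) (simp_all add: y_def)
  also have "\<dots> = e * (\<Sum>b\<in>insert b A. \<bar>h \<bullet> b\<bar>)"
    using insert.hyps by (simp add: s_def algebra_simps)
  finally show ?case .
qed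

theorem has_derivative_of_continuous_partials:
  fixes f :: "'a::euclidean_space \<Rightarrow> 'b::real_normed_vector"
  assumes "open S" "x \<in> S"
    and deriv: "\<And>y b. y \<in> S \<Longrightarrow> b \<in> Basis \<Longrightarrow>
      ((\<lambda>t::real. f (y + t *\<^sub>R b)) has_vector_derivative g b y) (at 0)"
    and cont: "\<And>b. b \<in> Basis \<Longrightarrow> continuous_on S (g b)"
  shows "(f has_derivative (\<lambda>h. \<Sum>b\<in>Basis. (h \<bullet> b) *\<^sub>R g b x)) (at x)"
  unfolding has_derivative_at_alt
proof (intro conjI allI impI)
  show "bounded_linear (\<lambda>h. \<Sum>b\<in>Basis. (h \<bullet> b) *\<^sub>R g b x)"
    by (intro bounded_linear_sum bounded_linear_scaleR_const bounded_linear_inner_left)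
  fix e :: real assume "e > 0"
  define n where "n = real DIM('a)"
  have n: "n > 0" by (simp add: n_def)
  \<comment> \<open>The sum of the absolute coordinates of \<open>h\<close> is at most \<open>n * norm h\<close>, so both the error and the
      radius have to be divided by \<open>n\<close>.\<close>
  have "\<forall>b\<in>Basis. \<exists>r>0. \<forall>y. dist y x < r \<longrightarrow> dist (g b y) (g b x) < e / n"
  proof
    fix b :: 'a assume "b \<in> Basis"
    then have "isCont (g b) x"
      using cont assms(1,2) continuous_on_eq_continuous_at by blast
    moreover have "e / n > 0" using \<open>e > 0\<close> n by simp
    ultimately show "\<exists>r>0. \<forall>y. dist y x < r \<longrightarrow> dist (g b y) (g b x) < e / n"
      unfolding continuous_at_eps_delta by blast
  qed
  then obtain r where r: "\<And>b. b \<in> Basis \<Longrightarrow> r b > 0"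
    "\<And>b y. b \<in> Basis \<Longrightarrow> dist y x < r b \<Longrightarrow> dist (g b y) (g b x) < e / n"
    by metis
  obtain r0 where r0: "r0 > 0" "ball x r0 \<subseteq> S"
    using assms(1,2) openE by blast
  define d where "d = min r0 (Min (r ` Basis))"
  have d: "d > 0" "d \<le> r0" "\<And>b. b \<in> Basis \<Longrightarrow> d \<le> r b"
    using r0(1) r(1) by (auto simp: d_def min_le_iff_disj)
  have l1: "(\<Sum>b\<in>Basis. \<bar>h \<bullet> b\<bar>) \<le> n * norm h" for h :: 'a
    unfolding n_def by (rule sum_bounded_above) (simp add: Basis_le_norm)
  show "\<exists>d>0. \<forall>y. norm (y - x) < d \<longrightarrow>
      norm (f y - f x - (\<Sum>b\<in>Basis. ((y - x) \<bullet> b) *\<^sub>R g b x)) \<le> e * norm (y - x)"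
  proof (intro exI[of _ "d / n"] conjI allI impI)
    show "d / n > 0" using d n by simp
    fix y assume y: "norm (y - x) < d / n"
    have "norm (f (x + (\<Sum>b\<in>Basis. ((y - x) \<bullet> b) *\<^sub>R b)) - f x
          - (\<Sum>b\<in>Basis. ((y - x) \<bullet> b) *\<^sub>R g b x))
        \<le> e / n * (\<Sum>b\<in>Basis. \<bar>(y - x) \<bullet> b\<bar>)"
    proof (rule coordinatewise_increment_bound[where d = d])
      fix z b assume z: "z \<in> ball x d" "b \<in> (Basis :: 'a set)"
      then have "z \<in> S" "dist z x < r b"
        using d(2) d(3)[OF z(2)] r0(2) by (auto simp: dist_commute)
      then show "((\<lambda>t. f (z + t *\<^sub>R b)) has_vector_derivative g b z) (at 0)"
        "norm (g b z - g b x) \<le> e / n"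
        using deriv z(2) r(2)[of b z] by (auto simp: dist_norm)
    next
      show "(\<Sum>b\<in>Basis. \<bar>(y - x) \<bullet> b\<bar>) < d"
        using l1[of "y - x"] y n by (simp add: field_simps)
    qed auto
    also have "\<dots> \<le> e / n * (n * norm (y - x))"
      using l1 \<open>e > 0\<close> n by (intro mult_left_mono) auto
    finally show "norm (f y - f x - (\<Sum>b\<in>Basis. ((y - x) \<bullet> b) *\<^sub>R g b x)) \<le> e * norm (y - x)"
      using n by (simp add: euclidean_representation)
  qed
qed

section \<open>The differential in terms of HR derivatives\<close>

lemma quat_rot_simps:
  "quat_rot 1 p = p"
  "quat_rot quat_i p = Quat (q_a p) (q_b p) (- q_c p) (- q_d p)"
  "quat_rot quat_j p = Quat (q_a p) (- q_b p) (q_c p) (- q_d p)"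
  "quat_rot quat_k p = Quat (q_a p) (- q_b p) (- q_c p) (q_d p)"
  by (simp_all add: quat_rot_def inverse_quat_def quat_eq_iff)

lemma sum_Basis_quat:
  "(\<Sum>b\<in>Basis. F b) = F 1 + F quat_i + F quat_j + F (quat_k :: quat)"
proof -
  have "distinct [1, quat_i, quat_j, quat_k]" by (simp add: quat_eq_iff)
  then show ?thesis by (simp add: Basis_quat_def add.assoc)
qed

text \<open>
  Summing \<open>p\<^sup>\<mu>\<close> over the four units kills the imaginary part of \<open>p\<close>; applied to \<open>p = e h\<close> this leaves
  only a multiple of the coordinate of \<open>h\<close> along \<open>e\<close>.
\<close>

lemma HR_deriv_sum:
  "HR_deriv 1 f q * h + HR_deriv quat_i f q * quat_rot quat_i h
      + HR_deriv quat_j f q * quat_rot quat_j h + HR_deriv quat_k f q * quat_rot quat_k h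
    = (\<Sum>b\<in>Basis. (h \<bullet> b) *\<^sub>R quat_partial b f q)"
  by (simp add: sum_Basis_quat HR_deriv_def quat_rot_simps quat_eq_iff inner_quat_def
      algebra_simps)

lemma HR_deriv_cnj_sum:
  "HR_deriv_cnj 1 f q * quat_cnj h + HR_deriv_cnj quat_i f q * quat_cnj (quat_rot quat_i h)
      + HR_deriv_cnj quat_j f q * quat_cnj (quat_rot quat_j h)
      + HR_deriv_cnj quat_k f q * quat_cnj (quat_rot quat_k h)
    = (\<Sum>b\<in>Basis. (h \<bullet> b) *\<^sub>R quat_partial b f q)"
  by (simp add: sum_Basis_quat HR_deriv_cnj_def quat_rot_simps quat_cnj_def quat_eq_iff
      inner_quat_def algebra_simps)

text \<open>Evaluating the differential at a unit \<open>b\<close> inverts the definition of the HR derivatives.\<close>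

lemma quat_partial_eq_HR_deriv_sum:
  assumes "b \<in> Basis"
  shows "quat_partial b f q = HR_deriv 1 f q * b + HR_deriv quat_i f q * quat_rot quat_i b
      + HR_deriv quat_j f q * quat_rot quat_j b + HR_deriv quat_k f q * quat_rot quat_k b"
proof -
  have "(\<Sum>c\<in>Basis. (b \<bullet> c) *\<^sub>R quat_partial c f q)
      = (\<Sum>c\<in>Basis. if c = b then quat_partial c f q else 0)"
    using assms by (intro sum.cong) (auto simp: inner_Basis)
  also have "\<dots> = quat_partial b f q"
    using assms by simp
  finally show ?thesis by (simp add: HR_deriv_sum)
qed

lemma has_derivative_HR:
  assumes "open S" "q \<in> S"
    and diff: "\<forall>q\<in>S. HR_differentiable_at f q"
    and cont: "\<forall>\<mu>\<in>quat_units. continuous_on S (HR_deriv \<mu> f)"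
  shows "(f has_derivative (\<lambda>h. \<Sum>b\<in>Basis. (h \<bullet> b) *\<^sub>R quat_partial b f q)) (at q)"
proof (rule has_derivative_of_continuous_partials[OF assms(1,2)])
  fix b :: quat assume b: "b \<in> Basis"
  then have "b \<in> quat_units" by (simp add: Basis_quat_def quat_units_def)
  then show "((\<lambda>t. f (y + t *\<^sub>R b)) has_vector_derivative quat_partial b f y) (at 0)"
    if "y \<in> S" for y
    using diff that
    by (simp add: HR_differentiable_at_def quat_partial_def vector_derivative_works)
  have "continuous_on S (\<lambda>q. HR_deriv 1 f q * b + HR_deriv quat_i f q * quat_rot quat_i b
      + HR_deriv quat_j f q * quat_rot quat_j b + HR_deriv quat_k f q * quat_rot quat_k b)"
    using cont by (intro continuous_intros) (auto simp: quat_units_def)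
  then show "continuous_on S (quat_partial b f)"
    by (simp add: quat_partial_eq_HR_deriv_sum[OF b, abs_def])
qed

section \<open>The mean value theorem in integral form\<close>

theorem theorem3p15:
  fixes S :: "quat set" and f :: "quat \<Rightarrow> quat" and q0 q1 lam :: quat
  assumes "open S"
    and "continuous_on S f"
    and "\<forall>q\<in>S. HR_differentiable_at f q"
    and "\<forall>\<mu>\<in>quat_units. continuous_on S (HR_deriv \<mu> f)"
    and "\<forall>\<mu>\<in>quat_units. continuous_on S (HR_deriv_cnj \<mu> f)"
    and "q0 \<in> S" and "q1 \<in> S" and "closed_segment q0 q1 \<subseteq> S"
    and "lam = q1 - q0"
  shows "((\<lambda>t::real.
            HR_deriv 1 f (q0 + t *\<^sub>R lam) * lam
          + HR_deriv quat_i f (q0 + t *\<^sub>R lam) * quat_rot quat_i lam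
          + HR_deriv quat_j f (q0 + t *\<^sub>R lam) * quat_rot quat_j lam
          + HR_deriv quat_k f (q0 + t *\<^sub>R lam) * quat_rot quat_k lam)
          has_integral (f q1 - f q0)) {0..1}
    \<and> ((\<lambda>t::real.
            HR_deriv_cnj 1 f (q0 + t *\<^sub>R lam) * quat_cnj lam
          + HR_deriv_cnj quat_i f (q0 + t *\<^sub>R lam) * quat_cnj (quat_rot quat_i lam)
          + HR_deriv_cnj quat_j f (q0 + t *\<^sub>R lam) * quat_cnj (quat_rot quat_j lam)
          + HR_deriv_cnj quat_k f (q0 + t *\<^sub>R lam) * quat_cnj (quat_rot quat_k lam))
          has_integral (f q1 - f q0)) {0..1}"
proof -
  let ?D = "\<lambda>q h. \<Sum>b\<in>Basis. (h \<bullet> b) *\<^sub>R quat_partial b f q"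
  have "((\<lambda>t. ?D (q0 + t *\<^sub>R lam) lam) has_integral
      f (q0 + 1 *\<^sub>R lam) - f (q0 + 0 *\<^sub>R lam)) {0..1}"
  proof (rule fundamental_theorem_of_calculus)
    fix t :: real assume t: "t \<in> {0..1}"
    then have "q0 + t *\<^sub>R lam \<in> closed_segment q0 q1"
      by (auto simp: closed_segment_def assms(9) algebra_simps intro!: exI[of _ t])
    then have "(f has_derivative ?D (q0 + t *\<^sub>R lam)) (at (q0 + t *\<^sub>R lam))"
      using assms by (intro has_derivative_HR) auto
    moreover have "((\<lambda>t. q0 + t *\<^sub>R lam) has_vector_derivative lam) (at t within {0..1})"
      by (auto intro!: derivative_eq_intros)
    ultimately show "((\<lambda>t. f (q0 + t *\<^sub>R lam)) has_vector_derivative ?D (q0 + t *\<^sub>R lam) lam)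
        (at t within {0..1})"
      using vector_derivative_diff_chain_within[of "\<lambda>t. q0 + t *\<^sub>R lam" lam t "{0..1}" f]
      by (auto simp: o_def intro: has_derivative_at_withinI)
  qed simp
  then have "((\<lambda>t. ?D (q0 + t *\<^sub>R lam) lam) has_integral (f q1 - f q0)) {0..1}"
    by (simp add: assms(9))
  then show ?thesis
    by (simp add: HR_deriv_sum HR_deriv_cnj_sum)
qed

end
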